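(* Let $X$ be a $T_1$ space and let $\mathbb{P}\subseteq\mathcal{O}(X)$ be a subbasis of $X$, partially ordered by $\leq\ =\ \subseteq$. Let $\Theta$ be a coinitial subset of $\mathcal{C}_X(\mathbb{P})$, i.e. $\Theta\subseteq\mathcal{C}_X(\mathbb{P})$ and every $D\in\mathcal{C}_X(\mathbb{P})$ is refined by some $C\in\Theta$. Then $X$ is homeomorphic to the spectrum $\widehat{\Theta}$ via the map $$x\mapsto\mathbb{P}_x=\{N\in\mathbb{P}:x\in N\}.$$
   Context: $\mathcal{O}(X)$ is the family of open subsets of $X$. A family $\mathbb{P}\subseteq\mathcal{O}(X)$ is a subbasis if the finite intersections of its elements (including the empty intersection, which is $X$) form a basis of $X$. $\mathcal{C}_X(\mathbb{P})=\{C\subseteq\mathbb{P}:X\subseteq\bigcup C\}$. For $R,S\subseteq\mathbb{P}$, "$R$ refines $S$" ($R\leq S$) means $\forall r\in R\ \exists s\in S\ (r\leq s)$. For a poset $(\mathbb{P},\leq)$ and $\Theta\subseteq\mathcal{P}(\mathbb{P})$ (power set), a subset $R\subseteq\mathbb{P}$ is an up-set if $r\leq p$ and $r\in R$ imply $p\in R$; it is $\Theta$-Cauchy if $C\cap R\neq\emptyset$ for all $C\in\Theta$; it is $\Theta$-round if for every $r\in R$ there is $C\in\Theta$ such that $c\leq r$ for all $c\in C\cap R$. The spectrum $\widehat\Theta$ is the set of all $\Theta$-round $\Theta$-Cauchy up-sets $R\subseteq\mathbb{P}$, with the topology having subbasis $(\widehat\Theta_p)_{p\in\mathbb{P}}$,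 where $\widehat\Theta_p=\{R\in\widehat\Theta:p\in R\}$. *)

theory Defs
  imports "HOL-Analysis.Analysis"
begin

text \<open>A poset is given by a carrier set \<open>P\<close> and an order relation \<open>le\<close>, of which only the
  restriction to \<open>P\<close> matters.\<close>

definition order_refines :: "('b \<Rightarrow> 'b \<Rightarrow> bool) \<Rightarrow> 'b set \<Rightarrow> 'b set \<Rightarrow> bool"
  where "order_refines le R S \<longleftrightarrow> (\<forall>r\<in>R. \<exists>s\<in>S. le r s)"

definition coinitial_in :: "('c \<Rightarrow> 'c \<Rightarrow> bool) \<Rightarrow> 'c set \<Rightarrow> 'c set \<Rightarrow> bool"
  where "coinitial_in le F T \<longleftrightarrow> T \<subseteq> F \<and> (\<forall>D\<in>F. \<exists>C\<in>T. le C D)"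

definition up_set_in :: "'b set \<Rightarrow> ('b \<Rightarrow> 'b \<Rightarrow> bool) \<Rightarrow> 'b set \<Rightarrow> bool"
  where "up_set_in P le R \<longleftrightarrow> R \<subseteq> P \<and> (\<forall>r\<in>R. \<forall>p\<in>P. le r p \<longrightarrow> p \<in> R)"

definition cauchy_set :: "'b set set \<Rightarrow> 'b set \<Rightarrow> bool"
  where "cauchy_set \<Theta> R \<longleftrightarrow> (\<forall>C\<in>\<Theta>. C \<inter> R \<noteq> {})"

definition round_set :: "('b \<Rightarrow> 'b \<Rightarrow> bool) \<Rightarrow> 'b set set \<Rightarrow> 'b set \<Rightarrow> bool"
  where "round_set le \<Theta> R \<longleftrightarrow> (\<forall>r\<in>R. \<exists>C\<in>\<Theta>. \<forall>c\<in>C \<inter> R. le c r)"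

definition spectrum_points :: "'b set \<Rightarrow> ('b \<Rightarrow> 'b \<Rightarrow> bool) \<Rightarrow> 'b set set \<Rightarrow> 'b set set"
  where "spectrum_points P le \<Theta> =
    {R. up_set_in P le R \<and> cauchy_set \<Theta> R \<and> round_set le \<Theta> R}"

definition spectrum_subbasic :: "'b set \<Rightarrow> ('b \<Rightarrow> 'b \<Rightarrow> bool) \<Rightarrow> 'b set set \<Rightarrow> 'b \<Rightarrow> 'b set set"
  where "spectrum_subbasic P le \<Theta> p = {R \<in> spectrum_points P le \<Theta>. p \<in> R}"

text \<open>Using \<open>relative_to\<close> makes the empty intersection the whole space. The library's
  \<open>topology_generated_by\<close> omits the empty intersection, so with it points lying in no subbasic
  set would be lost.\<close>

definition spectrum_topology :: "'b set \<Rightarrow> ('b \<Rightarrow> 'b \<Rightarrow> bool) \<Rightarrow> 'b set set \<Rightarrow> 'b set topology"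
  where "spectrum_topology P le \<Theta> =
    topology (arbitrary union_of
      (finite intersection_of (\<lambda>U. U \<in> spectrum_subbasic P le \<Theta> ` P)
        relative_to spectrum_points P le \<Theta>))"

definition subbasis_of :: "'a topology \<Rightarrow> 'a set set \<Rightarrow> bool"
  where "subbasis_of X P \<longleftrightarrow> (\<forall>U\<in>P. openin X U) \<and>
    openin X = arbitrary union_of (finite intersection_of (\<lambda>U. U \<in> P) relative_to topspace X)"

definition covers_from :: "'a topology \<Rightarrow> 'a set set \<Rightarrow> 'a set set set"
  where "covers_from X P = {C. C \<subseteq> P \<and> topspace X \<subseteq> \<Union>C}"

lemma topspace_spectrum_topology [simp]:
  "topspace (spectrum_topology P le \<Theta>) = spectrum_points P le \<Theta>"
  by (simp add: spectrum_topology_def)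

lemma subbasis_of_spectrum_topology:
  "subbasis_of (spectrum_topology P le \<Theta>) (spectrum_subbasic P le \<Theta> ` P)"
proof -
  let ?S = "spectrum_points P le \<Theta>" and ?B = "spectrum_subbasic P le \<Theta> ` P"
  have op: "openin (spectrum_topology P le \<Theta>) =
      arbitrary union_of (finite intersection_of (\<lambda>U. U \<in> ?B) relative_to ?S)"
    unfolding spectrum_topology_def by (rule ext) (simp add: openin_subbase)
  moreover have "openin (spectrum_topology P le \<Theta>) U" if "U \<in> ?B" for U
  proof -
    have "U \<subseteq> ?S" using that by (auto simp: spectrum_subbasic_def)
    with that show ?thesis unfolding op
      by (simp add: arbitrary_union_of_inc finite_intersection_of_inc relative_to_subset_inc)
  qed
  ultimately show ?thesis by (simp add: subbasis_of_def)
qed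

end

theory Submission
  imports Defs
begin

text \<open>
  For a point \<open>x\<close> write \<open>P\<^sub>x\<close> for the family of subbasic sets containing \<open>x\<close>. Everything rests on
  choosing one suitable cover \<open>D \<subseteq> P\<close> and passing to a member of \<open>\<Theta>\<close> that refines it.

  Each \<open>P\<^sub>x\<close> is a spectrum point. The condition needing an argument is roundness: for \<open>N \<in> P\<^sub>x\<close>,
  the \<open>T\<^sub>1\<close> property ensures that \<open>N\<close> together with all members of \<open>P\<close> missing \<open>x\<close> covers
  the space. A member of a refinement that contains \<open>x\<close> cannot lie in a set missing \<open>x\<close>, so it
  lies in \<open>N\<close>.

  Each spectrum point \<open>R\<close> is some \<open>P\<^sub>x\<close>. If \<open>P - R\<close> covered the space, some \<open>C \<in> \<Theta>\<close> would refine
  it; the Cauchy condition gives a member of \<open>C\<close> in \<open>R\<close>, and since \<open>R\<close> is an up-set the member of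
  \<open>P - R\<close> above it would lie in \<open>R\<close> too. So some \<open>x\<close> is missed by \<open>\<Union>(P - R)\<close>, which says
  \<open>P\<^sub>x \<subseteq> R\<close>. Conversely, given \<open>r \<in> R\<close>, roundness yields a cover in \<open>\<Theta>\<close> whose members in \<open>R\<close> all
  lie below \<open>r\<close>; one of its members contains \<open>x\<close>, hence is in \<open>P\<^sub>x \<subseteq> R\<close>, and so \<open>x \<in> r\<close>.

  Injectivity of \<open>x \<mapsto> P\<^sub>x\<close> is again the \<open>T\<^sub>1\<close> property, and the resulting bijection matches each
  \<open>N \<in> P\<close> with the subbasic set of the spectrum indexed by \<open>N\<close>, so it is a homeomorphism.
\<close>

text \<open>A basic neighbourhood inside \<open>U\<close> is a finite intersection of subbasic sets, and a point of the
  space outside \<open>U\<close> is missed by one of the factors.\<close>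
lemma subbasis_of_separates:
  assumes P: "subbasis_of X P" and U: "openin X U" "x \<in> U"
    and y: "y \<in> topspace X" "y \<notin> U"
  obtains N where "N \<in> P" "x \<in> N" "y \<notin> N"
proof -
  have "(arbitrary union_of (finite intersection_of (\<lambda>U. U \<in> P) relative_to topspace X)) U"
    using P U unfolding subbasis_of_def by metis
  then obtain B where "(finite intersection_of (\<lambda>U. U \<in> P) relative_to topspace X) B"
      "x \<in> B" "B \<subseteq> U"
    using \<open>x \<in> U\<close> unfolding union_of_def by blast
  then obtain F where F: "F \<subseteq> P" "B = topspace X \<inter> \<Inter>F"
    unfolding relative_to_def intersection_of_def by blast
  then obtain N where "N \<in> F" "y \<notin> N"
    using y \<open>B \<subseteq> U\<close> by blast
  with F \<open>x \<in> B\<close> show thesis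
    by (intro that) auto
qed

lemma t1_space_subbasis_separates:
  assumes "t1_space X" "subbasis_of X P" "x \<in> topspace X" "y \<in> topspace X" "x \<noteq> y"
  obtains N where "N \<in> P" "x \<in> N" "y \<notin> N"
proof -
  obtain U where "openin X U" "x \<in> U" "y \<notin> U"
    using assms(1,3-5) unfolding t1_space_def by blast
  then show thesis
    using subbasis_of_separates[OF assms(2) _ _ assms(4)] that by blast
qed

lemma subbasis_of_imp_openin:
  assumes "subbasis_of X P" "N \<in> P"
  shows "openin X N"
  using conjunct1[OF assms(1)[unfolded subbasis_of_def]] assms(2) by (rule bspec)

lemma continuous_map_into_subbasis_of:
  assumes P: "subbasis_of Y P"
    and f: "\<And>x. x \<in> topspace X \<Longrightarrow> f x \<in> topspace Y"
    and open_preimage: "\<And>N. N \<in> P \<Longrightarrow> openin X {x \<in> topspace X. f x \<in> N}"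
  shows "continuous_map X Y f"
proof -
  have "Y = topology (arbitrary union_of (finite intersection_of (\<lambda>U. U \<in> P) relative_to topspace Y))"
    using P unfolding subbasis_of_def by (metis openin_inverse)
  then show ?thesis
    using f open_preimage by (subst continuous_map_into_topology_subbase_eq) auto
qed

lemma coinitial_covers_refine:
  assumes "coinitial_in (order_refines (\<subseteq>)) (covers_from X P) \<Theta>"
    and "D \<subseteq> P" "topspace X \<subseteq> \<Union>D"
  shows "\<exists>C\<in>\<Theta>. \<forall>c\<in>C. \<exists>d\<in>D. c \<subseteq> d"
proof -
  have "D \<in> covers_from X P"
    using assms(2,3) by (simp add: covers_from_def)
  then show ?thesis
    using assms(1) by (simp add: coinitial_in_def order_refines_def)
qed

lemma coinitial_coversD:
  assumes "coinitial_in le (covers_from X P) \<Theta>" "C \<in> \<Theta>"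
  shows "C \<subseteq> P" "topspace X \<subseteq> \<Union>C"
proof -
  have "C \<in> covers_from X P"
    using assms unfolding coinitial_in_def by blast
  then show "C \<subseteq> P" "topspace X \<subseteq> \<Union>C"
    by (simp_all add: covers_from_def)
qed

text \<open>The \<open>T\<^sub>1\<close> property enters through roundness only: being an up-set is monotonicity of
  membership, and the Cauchy condition says that the members of \<open>\<Theta>\<close> cover \<open>x\<close>.\<close>
lemma neighbourhood_family_in_spectrum_points:
  assumes T1: "t1_space X" and P: "subbasis_of X P"
    and \<Theta>: "coinitial_in (order_refines (\<subseteq>)) (covers_from X P) \<Theta>"
    and x: "x \<in> topspace X"
  shows "{N \<in> P. x \<in> N} \<in> spectrum_points P (\<subseteq>) \<Theta>"
proof -
  have "up_set_in P (\<subseteq>) {N \<in> P. x \<in> N}"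
    by (auto simp: up_set_in_def)
  moreover have "cauchy_set \<Theta> {N \<in> P. x \<in> N}"
    using coinitial_coversD[OF \<Theta>] x unfolding cauchy_set_def by fastforce
  moreover have "\<exists>C\<in>\<Theta>. \<forall>c\<in>C \<inter> {N \<in> P. x \<in> N}. c \<subseteq> N" if N: "N \<in> P" "x \<in> N" for N
  proof -
    \<comment> \<open>In a cover refining \<open>?D\<close>, the sets around \<open>x\<close> are forced below \<open>N\<close>, the only member
      of \<open>?D\<close> that contains \<open>x\<close>.\<close>
    let ?D = "insert N {M \<in> P. x \<notin> M}"
    have covers: "topspace X \<subseteq> \<Union>?D"
    proof
      fix y assume "y \<in> topspace X"
      then show "y \<in> \<Union>?D"
        using N t1_space_subbasis_separates[OF T1 P _ x] by (cases "y = x") blast+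
    qed
    have "?D \<subseteq> P"
      using N by blast
    from coinitial_covers_refine[OF \<Theta> this covers]
    obtain C where "C \<in> \<Theta>" "\<forall>c\<in>C. \<exists>d\<in>?D. c \<subseteq> d"
      by (rule bexE)
    then show ?thesis
      by blast
  qed
  ultimately show ?thesis
    by (auto simp: spectrum_points_def round_set_def)
qed

text \<open>An up-set \<open>R\<close> meeting every cover in \<open>\<Theta>\<close> has a complement in \<open>P\<close> that cannot cover the space,
  and any uncovered point represents \<open>R\<close>. The Cauchy and up-set conditions keep \<open>R\<close> large enough
  to contain all sets around that point, and roundness forbids any others.\<close>
lemma spectrum_point_is_neighbourhood_family:
  assumes \<Theta>: "coinitial_in (order_refines (\<subseteq>)) (covers_from X P) \<Theta>"
    and R: "R \<in> spectrum_points P (\<subseteq>) \<Theta>"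
  obtains x where "x \<in> topspace X" "R = {N \<in> P. x \<in> N}"
proof -
  have up_set: "up_set_in P (\<subseteq>) R" and "cauchy_set \<Theta> R" and "round_set (\<subseteq>) \<Theta> R"
    using R by (simp_all add: spectrum_points_def)
  have cauchy: "C \<inter> R \<noteq> {}" if "C \<in> \<Theta>" for C
    using \<open>cauchy_set \<Theta> R\<close> that unfolding cauchy_set_def by (rule bspec)
  have round: "\<exists>C\<in>\<Theta>. \<forall>c\<in>C \<inter> R. c \<subseteq> r" if "r \<in> R" for r
    using \<open>round_set (\<subseteq>) \<Theta> R\<close> that unfolding round_set_def by (rule bspec)
  have "R \<subseteq> P"
    using up_set by (simp add: up_set_in_def)
  have "\<not> topspace X \<subseteq> \<Union>(P - R)"
  proof
    assume "topspace X \<subseteq> \<Union>(P - R)"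
    from coinitial_covers_refine[OF \<Theta> Diff_subset this]
    obtain C where C: "C \<in> \<Theta>" "\<forall>c\<in>C. \<exists>d\<in>P - R. c \<subseteq> d"
      by (rule bexE)
    from cauchy[OF C(1)] obtain c where "c \<in> C" "c \<in> R"
      by blast
    from C(2) \<open>c \<in> C\<close> obtain d where "d \<in> P - R" "c \<subseteq> d"
      by blast
    with up_set \<open>c \<in> R\<close> show False
      unfolding up_set_in_def by blast
  qed
  then obtain x where x: "x \<in> topspace X" and sub: "{N \<in> P. x \<in> N} \<subseteq> R"
    by blast
  have "x \<in> r" if r: "r \<in> R" for r
  proof -
    from round[OF r] obtain C where C: "C \<in> \<Theta>" "\<forall>c\<in>C \<inter> R. c \<subseteq> r"
      by (rule bexE)
    obtain c where c: "c \<in> C" "x \<in> c"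
      using coinitial_coversD(2)[OF \<Theta> C(1)] x by (meson UnionE subsetD)
    then have "c \<in> R"
      using coinitial_coversD(1)[OF \<Theta> C(1)] by (intro subsetD[OF sub]) auto
    with C(2) c have "c \<subseteq> r"
      by simp
    with c(2) show "x \<in> r"
      by (rule rev_subsetD)
  qed
  with sub \<open>R \<subseteq> P\<close> have "R = {N \<in> P. x \<in> N}"
    by blast
  with x show thesis
    by (rule that)
qed

theorem proposition3p5:
  fixes X :: "'a topology" and P :: "'a set set" and \<Theta> :: "'a set set set"
  assumes "t1_space X"
    and "subbasis_of X P"
    and "coinitial_in (order_refines (\<subseteq>)) (covers_from X P) \<Theta>"
  shows "homeomorphic_map X (spectrum_topology P (\<subseteq>) \<Theta>) (\<lambda>x. {N \<in> P. x \<in> N})"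
proof -
  let ?S = "spectrum_topology P (\<subseteq>) \<Theta>" and ?f = "\<lambda>x. {N \<in> P. x \<in> N}"
  define g where "g = inv_into (topspace X) ?f"
  have open_P: "openin X N" if "N \<in> P" for N
    using assms(2) that by (rule subbasis_of_imp_openin)
  have f_in: "?f x \<in> topspace ?S" if "x \<in> topspace X" for x
    using neighbourhood_family_in_spectrum_points[OF assms that] by simp
  have inj: "inj_on ?f (topspace X)"
  proof (rule inj_onI, rule ccontr)
    fix x y assume "x \<in> topspace X" "y \<in> topspace X" "?f x = ?f y" "x \<noteq> y"
    then show False
      using t1_space_subbasis_separates[OF assms(1,2), of x y] by blast
  qed
  have surj: "?f ` topspace X = topspace ?S"
  proof
    show "topspace ?S \<subseteq> ?f ` topspace X"
    proof
      fix R assume "R \<in> topspace ?S"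
      then have "R \<in> spectrum_points P (\<subseteq>) \<Theta>"
        by simp
      then obtain x where "x \<in> topspace X" "R = ?f x"
        by (rule spectrum_point_is_neighbourhood_family[OF assms(3)])
      then show "R \<in> ?f ` topspace X"
        by (rule image_eqI[rotated])
    qed
  qed (use f_in in blast)
  have gf: "g (?f x) = x" if "x \<in> topspace X" for x
    unfolding g_def by (rule inv_into_f_f[OF inj that])
  have fg: "?f (g R) = R" if "R \<in> topspace ?S" for R
    unfolding g_def by (rule f_inv_into_f) (use surj that in blast)
  have g_in: "g R \<in> topspace X" if "R \<in> topspace ?S" for R
    unfolding g_def by (rule inv_into_into) (use surj that in blast)
  have "continuous_map X ?S ?f"
  proof (rule continuous_map_into_subbasis_of[OF subbasis_of_spectrum_topology f_in])
    fix U assume "U \<in> spectrum_subbasic P (\<subseteq>) \<Theta> ` P"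
    then obtain N where N: "N \<in> P" "U = spectrum_subbasic P (\<subseteq>) \<Theta> N"
      by blast
    then have "{x \<in> topspace X. ?f x \<in> U} = N"
      using f_in openin_subset[OF open_P] by (auto simp: spectrum_subbasic_def)
    with N open_P show "openin X {x \<in> topspace X. ?f x \<in> U}"
      by simp
  qed
  moreover have "continuous_map ?S X g"
  proof (rule continuous_map_into_subbasis_of[OF assms(2) g_in])
    fix N assume N: "N \<in> P"
    have "g R \<in> N \<longleftrightarrow> N \<in> R" if "R \<in> topspace ?S" for R
      using fg[OF that] N by blast
    then have "{R \<in> topspace ?S. g R \<in> N} = spectrum_subbasic P (\<subseteq>) \<Theta> N"
      by (auto simp: spectrum_subbasic_def)
    then show "openin ?S {R \<in> topspace ?S. g R \<in> N}"
      using subbasis_of_imp_openin[OF subbasis_of_spectrum_topology imageI[OF N]] by simp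
  qed
  ultimately have "homeomorphic_maps X ?S ?f g"
    using gf fg by (simp add: homeomorphic_maps_def)
  then show ?thesis
    by (rule homeomorphic_maps_imp_map)
qed

end
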